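(* Let $(X,d)$ be a metric space with the contraction intersecting property. Suppose there exists a Radon measure $\mu$ on $X$ such that $\inf_{x\in X}\mu(B(x,r))=\sigma(r)>0$ for every $r>0$. Then $(X,d)$ has the Besicovitch covering property (BCP) if and only if it has the weak Besicovitch covering property (WBCP).
   Context: $B(x,r)=\{y\in X:d(x,y)\leqslant r\}$ is the closed ball with center $x$ and radius $r>0$; a ball is understood together with its center and radius. $\chi_E$ is the characteristic function of $E$. Contraction intersecting property: for each positive integer $m$ there exist $\beta\in(0,1)$, $s(m)\in(0,1)$ and $C(m)\in\mathbb{N}$ such that for every $R>0$ and every collection $\mathcal{F}$ of closed balls $B(x,r)$ with $\beta R\leqslant r\leqslant R$: whenever $B(x_1,r_1),\dots,B(x_{C(m)+1},r_{C(m)+1})$ are distinct balls of $\mathcal{F}$ with $\bigcap_{i=1}^{C(m)+1}B(x_i,r_i)\neq\emptyset$, there exist $m+1$ distinct indices $j_1,\dots,j_{m+1}\in\{1,\dots,C(m)+1\}$ such that $\bigcap_{i=1}^{m+1}B(x_{j_i},s(m)\,r_{j_i})\neq\emptyset$. BCP: there exists a constant $C$ such that for every $R>0$, every set $A\subset X$ and every collection $\mathcal{F}$ of balls $B(x,r)$ with $x\in A$, $0<r\leqslant R$, such that each point of $A$ is the center of some ball of $\mathcal{F}$, there is a subcollection $\mathcal{F}'\subset\mathcal{F}$ with $\chi_A\leqslant\sum_{B\in\mathcal{F}'}\chi_B\leqslant C$. Besicovitch family: a finite collection of balls $\{B(x_i,r_i)\}_{i=1}^n$ with $\bigcap_{i=1}^nB(x_i,r_i)\neq\emptyset$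 such that for every pair of distinct balls $B(x_i,r_i),B(x_j,r_j)$ in it, $x_j\notin B(x_i,r_i)$ and $x_i\notin B(x_j,r_j)$. WBCP: there exists a constant $L$ such that $\mathrm{Card}\,\mathcal{B}\leqslant L$ for every Besicovitch family $\mathcal{B}$ in $X$. *)

theory Defs
  imports "HOL-Analysis.Analysis"
begin

text \<open>
  A ball is a set together with a chosen center and radius, so collections of (closed) balls are
  sets of pairs \<open>(x, r)\<close> standing for \<open>cball x r\<close>. Two balls are distinct iff the pairs are distinct,
  even if the underlying point sets coincide. The metric space is the whole type \<open>'a\<close>; its
  properties take the type as an argument.
\<close>

text \<open>
  The subset \<open>G\<close> consists of the \<open>C + 1\<close> distinct balls, \<open>H\<close> of the \<open>m + 1\<close> selected ones
  (\<open>card G = C + 1\<close> forces \<open>G\<close> to be finite). The numbers \<open>\<beta>\<close>, \<open>s\<close> and \<open>C\<close> may all depend on \<open>m\<close>.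
\<close>

definition contraction_intersecting :: "'a::metric_space itself \<Rightarrow> bool" where
  "contraction_intersecting (_ :: 'a itself) \<longleftrightarrow>
    (\<forall>m::nat. 1 \<le> m \<longrightarrow>
      (\<exists>(\<beta>::real) (s::real) (C::nat). 0 < \<beta> \<and> \<beta> < 1 \<and> 0 < s \<and> s < 1 \<and>
        (\<forall>(R::real) (F :: ('a \<times> real) set).
          0 < R \<and> (\<forall>(x, r) \<in> F. \<beta> * R \<le> r \<and> r \<le> R) \<longrightarrow>
          (\<forall>G. G \<subseteq> F \<and> card G = C + 1 \<and> (\<Inter>(x, r)\<in>G. cball x r) \<noteq> {} \<longrightarrow>
            (\<exists>H. H \<subseteq> G \<and> card H = m + 1 \<and> (\<Inter>(x, r)\<in>H. cball x (s * r)) \<noteq> {})))))"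

text \<open>
  The sum of characteristic functions may have infinitely many terms; it is taken in
  \<open>[0, \<infinity>]\<close>, where it always converges.
\<close>

definition BCP :: "'a::metric_space itself \<Rightarrow> bool" where
  "BCP (_ :: 'a itself) \<longleftrightarrow>
    (\<exists>C::nat. \<forall>(R::real) (A :: 'a set) (F :: ('a \<times> real) set).
      0 < R \<and> (\<forall>(x, r) \<in> F. x \<in> A \<and> 0 < r \<and> r \<le> R) \<and> (\<forall>x\<in>A. \<exists>r. (x, r) \<in> F) \<longrightarrow>
      (\<exists>F'. F' \<subseteq> F \<and>
        (\<forall>z. indicator A z \<le> (\<Sum>\<^sub>\<infinity>(x, r)\<in>F'. indicator (cball x r) z :: ennreal) \<and>
             (\<Sum>\<^sub>\<infinity>(x, r)\<in>F'. indicator (cball x r) z :: ennreal) \<le> of_nat C)))"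

definition besicovitch_family :: "('a::metric_space \<times> real) set \<Rightarrow> bool" where
  "besicovitch_family B \<longleftrightarrow>
    finite B \<and> (\<forall>(x, r) \<in> B. 0 < r) \<and> (\<Inter>(x, r)\<in>B. cball x r) \<noteq> {} \<and>
    (\<forall>(x, r) \<in> B. \<forall>(y, t) \<in> B. (x, r) \<noteq> (y, t) \<longrightarrow> y \<notin> cball x r \<and> x \<notin> cball y t)"

definition WBCP :: "'a::metric_space itself \<Rightarrow> bool" where
  "WBCP (_ :: 'a itself) \<longleftrightarrow>
    (\<exists>L::nat. \<forall>B :: ('a \<times> real) set. besicovitch_family B \<longrightarrow> card B \<le> L)"

text \<open>
  A Radon measure is a Borel measure, finite on compact sets, outer regular on Borel sets and inner
  regular on open sets. It need not be finite or \<open>\<sigma>\<close>-finite.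
\<close>

definition radon_measure :: "'a::metric_space measure \<Rightarrow> bool" where
  "radon_measure M \<longleftrightarrow>
    sets M = sets borel \<and>
    (\<forall>K. compact K \<longrightarrow> emeasure M K < \<infinity>) \<and>
    (\<forall>A\<in>sets borel. emeasure M A = (INF U\<in>{U. open U \<and> A \<subseteq> U}. emeasure M U)) \<and>
    (\<forall>U. open U \<longrightarrow> emeasure M U = (SUP K\<in>{K. compact K \<and> K \<subseteq> U}. emeasure M K))"

end

theory Submission imports Defs begin

text \<open>
  That BCP implies WBCP is seen by applying BCP to a Besicovitch family and its set of centers: no
  ball of the family can be dropped. For the converse, sort the balls by radius into layers
  \<open>\<beta> ^ (k + 1) * R < r \<le> \<beta> ^ k * R\<close> and pass through the layers in order, choosing in layer \<open>k\<close> a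
  maximal \<open>\<beta> ^ (k + 1) * R\<close>-separated set of those centers that are not yet covered. Balls from
  different layers that share a point then form a Besicovitch family, so at most \<open>L\<close> layers meet at
  a point. Enlarging \<open>\<beta>\<close> so that \<open>s \<le> \<beta>\<close>, the balls of one layer become, after contraction by \<open>s\<close>,
  a Besicovitch family as soon as they have a common point, so the contraction intersecting
  property bounds the multiplicity within a layer. Zorn's lemma provides the maximal separated sets.
\<close>

section \<open>Maximal separated sets and selection by layers\<close>

lemma maximal_separated_subset:
  fixes U :: "'a::metric_space set"
  assumes "0 \<le> e"
  obtains S where "S \<subseteq> U" "\<And>x y. x \<in> S \<Longrightarrow> y \<in> S \<Longrightarrow> x \<noteq> y \<Longrightarrow> e < dist x y"
    "\<And>x. x \<in> U \<Longrightarrow> \<exists>y\<in>S. dist y x \<le> e"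
proof -
  let ?P = "{S. S \<subseteq> U \<and> (\<forall>x\<in>S. \<forall>y\<in>S. x \<noteq> y \<longrightarrow> e < dist x y)}"
  have "\<exists>M\<in>?P. \<forall>X\<in>?P. M \<subseteq> X \<longrightarrow> X = M"
  proof (rule subset_Zorn_nonempty)
    show "?P \<noteq> {}" by blast
  next
    fix C assume C: "C \<noteq> {}" "subset.chain ?P C"
    have "e < dist x y" if xy: "x \<in> \<Union>C" "y \<in> \<Union>C" "x \<noteq> y" for x y
    proof -
      from xy obtain X Y where XY: "X \<in> C" "x \<in> X" "Y \<in> C" "y \<in> Y" by blast
      with C(2) have "X \<subseteq> Y \<or> Y \<subseteq> X" by (auto simp: subset_chain_def)
      then obtain Z where "Z \<in> C" "x \<in> Z" "y \<in> Z" using XY by blast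
      with C(2) xy(3) show ?thesis by (auto simp: subset_chain_def)
    qed
    moreover have "\<Union>C \<subseteq> U" using C(2) by (auto simp: subset_chain_def)
    ultimately show "\<Union>C \<in> ?P" by blast
  qed
  then obtain M where M: "M \<in> ?P" and max: "\<forall>X\<in>?P. M \<subseteq> X \<longrightarrow> X = M"
    by (rule bexE)
  have "\<exists>y\<in>M. dist y x \<le> e" if x: "x \<in> U" for x
  proof (rule ccontr)
    assume neg: "\<not> ?thesis"
    then have far: "e < dist y x" if "y \<in> M" for y using that by (meson not_le)
    then have "insert x M \<in> ?P" using M x by (auto simp: dist_commute)
    from bspec[OF max this] have "x \<in> M" by blast
    \<comment> \<open>With \<open>x\<close> itself in \<open>M\<close>, \<open>far\<close> would
      give \<open>e < dist x x = 0\<close>.\<close>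
    then show False using far[of x] assms by simp
  qed
  with M show ?thesis by (intro that[of M]) auto
qed

text \<open>The levels are treated one after another. Stage \<open>n\<close> adds a maximal
  \<open>e n\<close>-separated set of those level-\<open>n\<close> centers that lie in no ball
  chosen before. A new center avoids the older balls, but an older center may lie in a new ball, so
  separation between different levels is stated in one direction only.\<close>

lemma layered_selection:
  fixes A :: "'a::metric_space set" and r :: "'a \<Rightarrow> real" and lev :: "'a \<Rightarrow> nat"
    and e :: "nat \<Rightarrow> real"
  assumes e: "\<And>k. 0 \<le> e k" and er: "\<And>x. x \<in> A \<Longrightarrow> e (lev x) \<le> r x"
  obtains S where "S \<subseteq> A" "\<And>x. x \<in> A \<Longrightarrow> \<exists>y\<in>S. dist y x \<le> r y"
    "\<And>x y. x \<in> S \<Longrightarrow> y \<in> S \<Longrightarrow> x \<noteq> y \<Longrightarrow> lev x = lev y \<Longrightarrow> e (lev x) < dist x y"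
    "\<And>x y. x \<in> S \<Longrightarrow> y \<in> S \<Longrightarrow> lev x < lev y \<Longrightarrow> r x < dist x y"
proof -
  define sep where "sep T \<longleftrightarrow> (\<forall>x\<in>T. \<forall>y\<in>T.
    (x \<noteq> y \<and> lev x = lev y \<longrightarrow> e (lev x) < dist x y) \<and> (lev x < lev y \<longrightarrow> r x < dist x y))" for T
  define P where "P n T \<longleftrightarrow> T \<subseteq> A \<and> (\<forall>x\<in>T. lev x < n) \<and> sep T \<and>
    (\<forall>x\<in>A. lev x < n \<longrightarrow> (\<exists>y\<in>T. dist y x \<le> r y))" for n T
  \<comment> \<open>Each stage depends on the previous one and is not unique, so the nested sequence
    comes from dependent choice.\<close>
  have "\<exists>T. \<forall>n. P n (T n) \<and> T n \<subseteq> T (Suc n)"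
  proof (rule dependent_nat_choice[where Q = "\<lambda>_ T T'. T \<subseteq> T'"])
    show "\<exists>T. P 0 T" unfolding P_def sep_def by auto
  next
    fix T n assume PT: "P n T"
    define U where "U = {x\<in>A. lev x = n \<and> (\<forall>y\<in>T. r y < dist y x)}"
    obtain V where V: "V \<subseteq> U" "\<And>x y. x \<in> V \<Longrightarrow> y \<in> V \<Longrightarrow> x \<noteq> y \<Longrightarrow> e n < dist x y"
      "\<And>x. x \<in> U \<Longrightarrow> \<exists>y\<in>V. dist y x \<le> e n"
      using maximal_separated_subset[OF e, of U n] by metis
    have "sep (T \<union> V)"
      unfolding sep_def
    proof (intro ballI)
      fix x y assume "x \<in> T \<union> V" "y \<in> T \<union> V"
      then consider "x \<in> T" "y \<in> T" | "x \<in> V" "y \<in> V" | "x \<in> T" "y \<in> V" | "x \<in> V" "y \<in> T"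
        by blast
      then show "(x \<noteq> y \<and> lev x = lev y \<longrightarrow> e (lev x) < dist x y) \<and>
        (lev x < lev y \<longrightarrow> r x < dist x y)"
      proof cases
        case 1
        then show ?thesis using PT unfolding P_def sep_def by simp
      next
        case 2
        then have "lev x = n" "lev y = n" using V(1) by (auto simp: U_def)
        then show ?thesis using 2 V(2) by simp
      next
        case 3
        then have "lev x < n" "lev y = n" "r x < dist x y" using PT V(1) by (auto simp: P_def U_def)
        then show ?thesis by simp
      next
        case 4
        then have "lev x = n" "lev y < n" using PT V(1) by (auto simp: P_def U_def)
        then show ?thesis by simp
      qed
    qed
    moreover have "\<exists>y\<in>T \<union> V. dist y x \<le> r y" if x: "x \<in> A" "lev x < Suc n" for x
    proof (cases "lev x < n")
      case True
      then show ?thesis using PT x unfolding P_def by blast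
    next
      case False
      with x have lx: "lev x = n" by simp
      show ?thesis
      \<comment> \<open>A point of \<open>U\<close> is within \<open>e n\<close> of some new center
        by maximality, and \<open>e n\<close> is at most the radius there. A level-\<open>n\<close>
        point outside \<open>U\<close> lies in an older ball.\<close>
      proof (cases "x \<in> U")
        case True
        then obtain y where y: "y \<in> V" "dist y x \<le> e n" using V(3) by blast
        then have "e n \<le> r y" using er[of y] V(1) by (auto simp: U_def)
        with y show ?thesis by force
      next
        case False
        then show ?thesis using x lx unfolding U_def by force
      qed
    qed
    moreover have "T \<union> V \<subseteq> A" using PT V(1) unfolding P_def U_def by blast
    moreover have "\<forall>x\<in>T \<union> V. lev x < Suc n" using PT V(1) by (auto simp: P_def U_def)
    ultimately have "P (Suc n) (T \<union> V)" unfolding P_def by blast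
    then show "\<exists>T'. P (Suc n) T' \<and> T \<subseteq> T'" by blast
  qed
  then obtain T where T: "\<And>n. P n (T n)" "\<And>n. T n \<subseteq> T (Suc n)" by blast
  have mono: "T m \<subseteq> T n" if "m \<le> n" for m n
    using lift_Suc_mono_le[of T, OF T(2) that] .
  \<comment> \<open>The stages are nested, so two points of the union share a stage and pairwise
    conditions pass to the union.\<close>
  have common: "\<exists>n. x \<in> T n \<and> y \<in> T n" if "x \<in> (\<Union>n. T n)" "y \<in> (\<Union>n. T n)" for x y
  proof -
    from that obtain m n where "x \<in> T m" "y \<in> T n" by blast
    then show ?thesis using mono[of m "max m n"] mono[of n "max m n"] by auto
  qed
  show ?thesis
  proof (rule that[of "\<Union>n. T n"])
    show "(\<Union>n. T n) \<subseteq> A" using T(1) unfolding P_def by blast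
  next
    fix x assume "x \<in> A"
    then have "\<exists>y\<in>T (Suc (lev x)). dist y x \<le> r y" using T(1) unfolding P_def by blast
    then show "\<exists>y\<in>\<Union>n. T n. dist y x \<le> r y" by blast
  next
    fix x y assume "x \<in> (\<Union>n. T n)" "y \<in> (\<Union>n. T n)" "x \<noteq> y" "lev x = lev y"
    then show "e (lev x) < dist x y" using common[of x y] T(1) unfolding P_def sep_def by metis
  next
    fix x y assume "x \<in> (\<Union>n. T n)" "y \<in> (\<Union>n. T n)" "lev x < lev y"
    then show "r x < dist x y" using common[of x y] T(1) unfolding P_def sep_def by metis
  qed
qed

section \<open>Multiplicities and geometric scales\<close>

text \<open>This turns the covering sum into a count of the balls through \<open>z\<close>.
  Finiteness matters, since \<open>card\<close> of an infinite set is 0.\<close>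

lemma infsum_indicator_cball:
  fixes F :: "('a::metric_space \<times> real) set"
  assumes "finite {(x, r) \<in> F. z \<in> cball x r}"
  shows "(\<Sum>\<^sub>\<infinity>(x, r)\<in>F. indicator (cball x r) z :: ennreal)
    = of_nat (card {(x, r) \<in> F. z \<in> cball x r})"
proof -
  have "(\<Sum>\<^sub>\<infinity>(x, r)\<in>F. indicator (cball x r) z :: ennreal)
      = (\<Sum>\<^sub>\<infinity>p\<in>{(x, r) \<in> F. z \<in> cball x r}. 1)"
    by (rule infsum_cong_neutral) (auto simp: indicator_def)
  also have "\<dots> = of_nat (card {(x, r) \<in> F. z \<in> cball x r})"
    using assms by (simp add: infsum_finite)
  finally show ?thesis .
qed

lemma power_layer:
  fixes \<beta> R r :: real
  assumes "0 < \<beta>" "\<beta> < 1" "0 < r" "r \<le> R"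
  obtains k where "\<beta> ^ Suc k * R < r" "r \<le> \<beta> ^ k * R"
proof -
  have R: "0 < R" using assms by simp
  obtain n where "\<beta> ^ n < r / R" using real_arch_pow_inv[of "r / R" \<beta>] assms R by auto
  then have n: "\<beta> ^ n * R < r" using R by (simp add: field_simps)
  \<comment> \<open>The least exponent that brings the scale below \<open>r\<close> is not 0 because
    \<open>r <= R\<close>; its predecessor is the layer sought.\<close>
  define m where "m = (LEAST n. \<beta> ^ n * R < r)"
  have m: "\<beta> ^ m * R < r" unfolding m_def by (rule LeastI[of _ n]) (rule n)
  then have "m \<noteq> 0" using assms by (cases m) auto
  then obtain k where k: "m = Suc k" by (cases m) auto
  then have "\<not> \<beta> ^ k * R < r" using not_less_Least[of k "\<lambda>n. \<beta> ^ n * R < r"] m_def by simp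
  with m k show ?thesis using that[of k] by simp
qed

section \<open>Comparison of the two covering properties\<close>

lemma BCP_imp_WBCP:
  assumes "BCP TYPE('a::metric_space)"
  shows "WBCP TYPE('a)"
proof -
  obtain C :: nat where C: "\<forall>R (A :: 'a set) F.
      0 < R \<and> (\<forall>(x, r) \<in> F. x \<in> A \<and> 0 < r \<and> r \<le> R) \<and> (\<forall>x\<in>A. \<exists>r. (x, r) \<in> F) \<longrightarrow>
      (\<exists>F'. F' \<subseteq> F \<and>
        (\<forall>z. indicator A z \<le> (\<Sum>\<^sub>\<infinity>(x, r)\<in>F'. indicator (cball x r) z :: ennreal) \<and>
             (\<Sum>\<^sub>\<infinity>(x, r)\<in>F'. indicator (cball x r) z :: ennreal) \<le> of_nat C))"
    using assms[unfolded BCP_def] by (elim exE) (rule that)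
  have "card B \<le> C" if B: "besicovitch_family B" for B :: "('a \<times> real) set"
  proof -
    have fin: "finite B" using B unfolding besicovitch_family_def by blast
    have pos: "0 < r" if "(x, r) \<in> B" for x r
      using B that unfolding besicovitch_family_def by auto
    have sep: "y \<notin> cball x r" if "(x, r) \<in> B" "(y, t) \<in> B" "(x, r) \<noteq> (y, t)" for x r y t
    proof -
      have "\<forall>(x, r) \<in> B. \<forall>(y, t) \<in> B. (x, r) \<noteq> (y, t) \<longrightarrow> y \<notin> cball x r \<and> x \<notin> cball y t"
        using B unfolding besicovitch_family_def by (elim conjE)
      from bspec[OF bspec[OF this that(1), unfolded prod.case] that(2), unfolded prod.case]
      show ?thesis using that(3) by blast
    qed
    have "(\<Inter>(x, r)\<in>B. cball x r) \<noteq> {}" using B by (simp add: besicovitch_family_def)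
    then obtain w where "w \<in> (\<Inter>(x, r)\<in>B. cball x r)" by blast
    then have w: "w \<in> cball x r" if "(x, r) \<in> B" for x r using that by auto
    \<comment> \<open>Inserting 1 keeps \<open>R\<close> positive and the maximum defined even for
      an empty family.\<close>
    define R where "R = Max (insert 1 (snd ` B))"
    have R: "0 < R" "\<And>x r. (x, r) \<in> B \<Longrightarrow> r \<le> R"
      unfolding R_def using fin by (force simp: less_max_iff_disj Max_gr_iff intro!: Max_ge)+
    have prem: "0 < R \<and> (\<forall>(x, r) \<in> B. x \<in> fst ` B \<and> 0 < r \<and> r \<le> R) \<and>
        (\<forall>x\<in>fst ` B. \<exists>r. (x, r) \<in> B)"
      using R pos by (force simp: image_iff)
    obtain F where F: "F \<subseteq> B"
      and lo: "\<And>z. indicator (fst ` B) z \<le> (\<Sum>\<^sub>\<infinity>(x, r)\<in>F. indicator (cball x r) z :: ennreal)"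
      and up: "\<And>z. (\<Sum>\<^sub>\<infinity>(x, r)\<in>F. indicator (cball x r) z :: ennreal) \<le> of_nat C"
      using C[THEN spec, of R, THEN spec, of "fst ` B", THEN spec, of B, THEN mp, OF prem]
      by (elim exE conjE) (rule that; blast)
    \<comment> \<open>The center \<open>x\<close> lies in no ball of \<open>B\<close> other than
      \<open>(x, r)\<close>, so covering \<open>x\<close> forces this ball into
      \<open>F\<close>.\<close>
    have sub: "B \<subseteq> F"
    proof clarify
      fix x r assume xr: "(x, r) \<in> B"
      have fin': "finite {(y, t) \<in> F. x \<in> cball y t}"
        by (rule finite_subset[OF _ fin]) (use F in auto)
      have "x \<in> fst ` B" using xr by force
      then have "1 \<le> (\<Sum>\<^sub>\<infinity>(y, t)\<in>F. indicator (cball y t) x :: ennreal)"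
        using lo[of x] by (simp only: indicator_simps)
      then have "{(y, t) \<in> F. x \<in> cball y t} \<noteq> {}"
        unfolding infsum_indicator_cball[OF fin'] by (metis card.empty not_one_le_zero of_nat_0)
      then obtain y t where yt: "(y, t) \<in> F" "x \<in> cball y t" by blast
      then have "(y, t) = (x, r)" using sep[of y t x r] xr F by blast
      with yt show "(x, r) \<in> F" by simp
    qed
    with F have FB: "F = B" by simp
    \<comment> \<open>The common point \<open>w\<close> lies in every ball, so the sum at
      \<open>w\<close> is the size of \<open>B\<close>.\<close>
    have eq: "{(x, r) \<in> B. w \<in> cball x r} = B" using w by blast
    have "(of_nat (card B) :: ennreal) \<le> of_nat C"
      using up[of w] infsum_indicator_cball[of B w] fin unfolding FB eq by simp
    then show ?thesis by simp
  qed
  then show ?thesis unfolding WBCP_def by blast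
qed

lemma WBCP_imp_BCP:
  assumes CI: "contraction_intersecting TYPE('a::metric_space)" and W: "WBCP TYPE('a)"
  shows "BCP TYPE('a)"
proof -
  obtain L where L: "\<And>B :: ('a \<times> real) set. besicovitch_family B \<Longrightarrow> card B \<le> L"
    using W unfolding WBCP_def by blast
  \<comment> \<open>The choice \<open>m = Suc L\<close> is admissible even for \<open>L = 0\<close>,
    and \<open>m + 1\<close> contracted balls are more than a Besicovitch family can have.\<close>
  have "1 \<le> Suc L" by simp
  note CI_L = mp[OF spec[OF CI[unfolded contraction_intersecting_def], of "Suc L"] this]
  obtain \<beta>0 s :: real and C :: nat where
    CI': "0 < \<beta>0 \<and> \<beta>0 < 1 \<and> 0 < s \<and> s < 1 \<and>
      (\<forall>(R::real) (F :: ('a \<times> real) set).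
        0 < R \<and> (\<forall>(x, r) \<in> F. \<beta>0 * R \<le> r \<and> r \<le> R) \<longrightarrow>
        (\<forall>G. G \<subseteq> F \<and> card G = C + 1 \<and> (\<Inter>(x, r)\<in>G. cball x r) \<noteq> {} \<longrightarrow>
          (\<exists>H. H \<subseteq> G \<and> card H = Suc L + 1 \<and> (\<Inter>(x, r)\<in>H. cball x (s * r)) \<noteq> {})))"
    using CI_L by (elim exE) (rule that)
  have \<beta>0: "0 < \<beta>0" "\<beta>0 < 1" and s: "0 < s" "s < 1" using CI' by simp_all
  have CI0: "\<exists>H. H \<subseteq> G \<and> card H = Suc L + 1 \<and> (\<Inter>(x, r)\<in>H. cball x (s * r)) \<noteq> {}"
    if "0 < R" "\<forall>(x, r) \<in> G. \<beta>0 * R \<le> r \<and> r \<le> R" "card G = C + 1"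
      "(\<Inter>(x, r)\<in>G. cball x r) \<noteq> {}"
    for R :: real and G :: "('a \<times> real) set"
    using CI'[THEN conjunct2, THEN conjunct2, THEN conjunct2, THEN conjunct2, THEN spec, of R,
        THEN spec, of G, THEN mp, THEN spec, of G, THEN mp] that by simp
  \<comment> \<open>\<open>\<beta>0 <= \<beta>\<close> keeps each layer within the radius range of
    the contraction property; \<open>s <= \<beta>\<close> makes the contracted radii no larger than
    the separation within the layer.\<close>
  define \<beta> where "\<beta> = max \<beta>0 s"
  have \<beta>: "0 < \<beta>" "\<beta> < 1" "\<beta>0 \<le> \<beta>" "s \<le> \<beta>" using \<beta>0 s unfolding \<beta>_def by auto
  have "\<exists>F'\<subseteq>F. \<forall>z. indicator A z \<le> (\<Sum>\<^sub>\<infinity>(x, r)\<in>F'. indicator (cball x r) z :: ennreal) \<and>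
      (\<Sum>\<^sub>\<infinity>(x, r)\<in>F'. indicator (cball x r) z :: ennreal) \<le> of_nat (L * C)"
    if R: "0 < R" and F: "\<forall>(x, r) \<in> F. x \<in> A \<and> 0 < r \<and> r \<le> R" and AF: "\<forall>x\<in>A. \<exists>r. (x, r) \<in> F"
    for R and A :: "'a set" and F
  proof -
    \<comment> \<open>One radius per center is fixed, so from here on distinct chosen balls have
      distinct centers.\<close>
    obtain r where rF: "\<And>x. x \<in> A \<Longrightarrow> (x, r x) \<in> F" using AF by metis
    then have r: "0 < r x" "r x \<le> R" if "x \<in> A" for x using F that by fast+
    have "\<forall>x\<in>A. \<exists>k. \<beta> ^ Suc k * R < r x \<and> r x \<le> \<beta> ^ k * R"
      using power_layer[OF \<beta>(1,2)] r by metis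
    then obtain lev where lev: "\<And>x. x \<in> A \<Longrightarrow> \<beta> ^ Suc (lev x) * R < r x"
      "\<And>x. x \<in> A \<Longrightarrow> r x \<le> \<beta> ^ lev x * R"
      by metis
    obtain S where S: "S \<subseteq> A" and cov: "\<And>x. x \<in> A \<Longrightarrow> \<exists>y\<in>S. dist y x \<le> r y"
      and sep: "\<And>x y. x \<in> S \<Longrightarrow> y \<in> S \<Longrightarrow> x \<noteq> y \<Longrightarrow> lev x = lev y \<Longrightarrow>
        \<beta> ^ Suc (lev x) * R < dist x y"
      and far: "\<And>x y. x \<in> S \<Longrightarrow> y \<in> S \<Longrightarrow> lev x < lev y \<Longrightarrow> r x < dist x y"
      by (rule layered_selection[of "\<lambda>k. \<beta> ^ Suc k * R" A lev r])
        (use \<beta> R lev(1) in \<open>auto intro: less_imp_le\<close>)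
    \<comment> \<open>Radii strictly decrease with the level. This supplies the direction of
      separation that \<open>far\<close> leaves out.\<close>
    have lev_less: "r y < r x" if "x \<in> S" "y \<in> S" "lev x < lev y" for x y
    proof -
      have "r y \<le> \<beta> ^ lev y * R" using lev(2) that S by blast
      also have "\<dots> \<le> \<beta> ^ Suc (lev x) * R"
        using \<beta> R that by (intro mult_right_mono power_decreasing) auto
      also have "\<dots> < r x" using lev(1) that S by blast
      finally show ?thesis .
    qed
    define N where "N z = {x \<in> S. dist x z \<le> r x}" for z
    \<comment> \<open>Bounding all finite subsets yields finiteness and the cardinality bound
      together.\<close>
    have layer: "finite {x \<in> N z. lev x = k} \<and> card {x \<in> N z. lev x = k} \<le> C" for z k
    proof (rule finite_if_finite_subsets_card_bdd)
      fix D assume D: "D \<subseteq> {x \<in> N z. lev x = k}" "finite D"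
      show "card D \<le> C"
      proof (rule ccontr)
        assume "\<not> card D \<le> C"
        then have "C + 1 \<le> card D" by simp
        then obtain D' where D': "D' \<subseteq> D" "card D' = C + 1"
          using obtain_subset_with_card_n by metis
        define G where "G = (\<lambda>x. (x, r x)) ` D'"
        have cardG: "card G = C + 1"
          unfolding G_def using D'(2) by (subst card_image) (auto intro: inj_onI)
        have DS: "x \<in> S" "x \<in> A" "lev x = k" "dist x z \<le> r x" if "x \<in> D'" for x
          using that D'(1) D(1) S by (auto simp: N_def)
        have "z \<in> (\<Inter>(x, r)\<in>G. cball x r)" using DS(4) by (auto simp: G_def)
        then have Gne: "(\<Inter>(x, r)\<in>G. cball x r) \<noteq> {}" by blast
        have pR: "0 < \<beta> ^ k * R" using \<beta> R by simp
        have rad: "\<beta>0 * (\<beta> ^ k * R) \<le> t \<and> t \<le> \<beta> ^ k * R" if "(x, t) \<in> G" for x t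
        proof -
          have x: "x \<in> D'" "t = r x" using that by (auto simp: G_def)
          have "\<beta>0 * (\<beta> ^ k * R) \<le> \<beta> * (\<beta> ^ k * R)"
            using \<beta> pR by (intro mult_right_mono) auto
          also have "\<dots> < r x" using lev(1)[of x] DS[OF x(1)] by (simp add: mult.assoc)
          finally show ?thesis using lev(2)[of x] DS[OF x(1)] x(2) by simp
        qed
        obtain H where H: "H \<subseteq> G" "card H = Suc L + 1" "(\<Inter>(x, r)\<in>H. cball x (s * r)) \<noteq> {}"
          using CI0[OF pR _ cardG Gne] rad by blast
        obtain w where w: "\<And>x t. (x, t) \<in> H \<Longrightarrow> w \<in> cball x (s * t)" using H(3) by fast
        define B where "B = (\<lambda>(x, t). (x, s * t)) ` H"
        have cardB: "card B = Suc L + 1"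
          unfolding B_def using s H(2) by (subst card_image) (auto intro: inj_onI)
        have BD: "x \<in> D' \<and> t = s * r x \<and> w \<in> cball x t" if "(x, t) \<in> B" for x t
          using that H(1) w by (auto simp: B_def G_def)
        \<comment> \<open>Here \<open>s * r x <= \<beta> * (\<beta> ^ k * R)\<close>, which is the
          separation of centers in layer \<open>k\<close>.\<close>
        have Bsep: "t < dist x y" if xt: "(x, t) \<in> B" "(y, u) \<in> B" "(x, t) \<noteq> (y, u)" for x y t u
        proof -
          have xy: "x \<in> D'" "y \<in> D'" "t = s * r x" "x \<noteq> y" using BD xt by auto
          have "t \<le> \<beta> * (\<beta> ^ k * R)"
            unfolding xy(3) using s \<beta> r lev(2)[of x] DS[OF xy(1)] by (intro mult_mono) force+
          also have "\<dots> < dist x y"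
            using sep[of x y] DS[OF xy(1)] DS[OF xy(2)] xy(4) by (simp add: mult.assoc)
          finally show ?thesis .
        qed
        have "besicovitch_family B"
          unfolding besicovitch_family_def
        proof (intro conjI)
          show "finite B" using cardB by (intro card_ge_0_finite) simp
          show "\<forall>(x, t)\<in>B. 0 < t" using BD s r DS by fastforce
          have "w \<in> (\<Inter>(x, t)\<in>B. cball x t)" using BD by blast
          then show "(\<Inter>(x, t)\<in>B. cball x t) \<noteq> {}" by blast
          show "\<forall>(x, t)\<in>B. \<forall>(y, u)\<in>B. (x, t) \<noteq> (y, u) \<longrightarrow> y \<notin> cball x t \<and> x \<notin> cball y u"
            using Bsep by (fastforce simp: not_le)
        qed
        then show False using L[of B] cardB by simp
      qed
    qed
    have levels: "finite (lev ` N z) \<and> card (lev ` N z) \<le> L" for z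
    proof (rule finite_if_finite_subsets_card_bdd)
      fix K assume K: "K \<subseteq> lev ` N z" "finite K"
      then have "\<forall>k\<in>K. \<exists>x. x \<in> N z \<and> lev x = k" by blast
      \<comment> \<open>\<open>p\<close> picks one ball through \<open>z\<close> from each level in
        \<open>K\<close>; it is injective because \<open>lev\<close> inverts it.\<close>
      then obtain p where p: "\<And>k. k \<in> K \<Longrightarrow> p k \<in> N z \<and> lev (p k) = k" by metis
      define B where "B = (\<lambda>k. (p k, r (p k))) ` K"
      have cardB: "card B = card K"
        unfolding B_def using p by (intro card_image inj_onI) (metis prod.inject)
      have pS: "p k \<in> S" "p k \<in> A" "dist (p k) z \<le> r (p k)" if "k \<in> K" for k
        using p[OF that] S by (auto simp: N_def)
      have Bsep: "r (p i) < dist (p i) (p j)" if ij: "i \<in> K" "j \<in> K" "i \<noteq> j" for i j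
      proof (cases "i < j")
        case True
        then show ?thesis using far[of "p i" "p j"] p pS ij by auto
      next
        case False
        \<comment> \<open>Now \<open>p j\<close> has the larger ball, so the distance exceeds
          \<open>r (p j)\<close> and hence also \<open>r (p i)\<close>.\<close>
        then have "j < i" using ij by simp
        then show ?thesis
          using far[of "p j" "p i"] lev_less[of "p j" "p i"] p pS ij by (auto simp: dist_commute)
      qed
      have "besicovitch_family B"
        unfolding besicovitch_family_def
      proof (intro conjI)
        show "finite B" unfolding B_def using K(2) by simp
        show "\<forall>(x, t)\<in>B. 0 < t" unfolding B_def using r pS by auto
        have "z \<in> (\<Inter>(x, t)\<in>B. cball x t)" using pS(3) by (auto simp: B_def)
        then show "(\<Inter>(x, t)\<in>B. cball x t) \<noteq> {}" by blast
        have "p j \<notin> cball (p i) (r (p i))" if "i \<in> K" "j \<in> K" "i \<noteq> j" for i j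
          using Bsep[OF that] by simp
        then show "\<forall>(x, t)\<in>B. \<forall>(y, u)\<in>B. (x, t) \<noteq> (y, u) \<longrightarrow> y \<notin> cball x t \<and> x \<notin> cball y u"
          unfolding B_def by (smt (verit) case_prodI2 imageE prod.inject)
      qed
      then show "card K \<le> L" using L[of B] cardB by simp
    qed
    have N_eq: "N z = (\<Union>k\<in>lev ` N z. {x \<in> N z. lev x = k})" for z by blast
    have finN: "finite (N z)" for z
      by (subst N_eq) (use layer levels in blast)
    \<comment> \<open>At most \<open>L\<close> levels occur among the balls through
      \<open>z\<close>, each with at most \<open>C\<close> balls.\<close>
    have cardN: "card (N z) \<le> L * C" for z
    proof -
      have "card (N z) \<le> (\<Sum>k\<in>lev ` N z. card {x \<in> N z. lev x = k})"
        by (subst N_eq) (use levels in \<open>blast intro: card_UN_le\<close>)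
      also have "\<dots> \<le> card (lev ` N z) * C"
        using layer sum_bounded_above[of "lev ` N z" "\<lambda>k. card {x \<in> N z. lev x = k}" C] by simp
      also have "\<dots> \<le> L * C" using levels by simp
      finally show ?thesis .
    qed
    define F' where "F' = (\<lambda>x. (x, r x)) ` S"
    have F'N: "{(x, t) \<in> F'. z \<in> cball x t} = (\<lambda>x. (x, r x)) ` N z" for z
      by (auto simp: F'_def N_def)
    have sum: "(\<Sum>\<^sub>\<infinity>(x, t)\<in>F'. indicator (cball x t) z :: ennreal) = of_nat (card (N z))" for z
    proof -
      have "finite {(x, t) \<in> F'. z \<in> cball x t}" unfolding F'N using finN by simp
      moreover have "card {(x, t) \<in> F'. z \<in> cball x t} = card (N z)"
        unfolding F'N by (intro card_image inj_onI) simp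
      ultimately show ?thesis by (simp only: infsum_indicator_cball)
    qed
    have "indicator A z \<le> (of_nat (card (N z)) :: ennreal)" for z
    proof (cases "z \<in> A")
      case True
      then have "N z \<noteq> {}" using cov[of z] by (auto simp: N_def)
      then have "1 \<le> card (N z)" using finN[of z] by (simp add: Suc_le_eq card_gt_0_iff)
      then have "(of_nat 1 :: ennreal) \<le> of_nat (card (N z))" by (rule of_nat_mono)
      then show ?thesis using True by simp
    qed simp
    moreover have "(of_nat (card (N z)) :: ennreal) \<le> of_nat (L * C)" for z
      by (rule of_nat_mono[OF cardN])
    moreover have "F' \<subseteq> F" unfolding F'_def using rF S by auto
    ultimately show ?thesis unfolding sum[symmetric] by (intro exI[of _ F'] conjI) simp_all
  qed
  then show ?thesis unfolding BCP_def by (intro exI[of _ "L * C"]) blast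
qed

theorem theorem4:
  fixes \<mu> :: "'a::metric_space measure" and \<sigma> :: "real \<Rightarrow> ennreal"
  assumes "contraction_intersecting TYPE('a)"
    and "radon_measure \<mu>"
    and "\<And>r::real. 0 < r \<Longrightarrow> (INF x. emeasure \<mu> (cball x r)) = \<sigma> r"
    and "\<And>r::real. 0 < r \<Longrightarrow> 0 < \<sigma> r"
  shows "BCP TYPE('a) \<longleftrightarrow> WBCP TYPE('a)"
  using BCP_imp_WBCP WBCP_imp_BCP[OF assms(1)] by blast

end
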